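(* Let $n\ge 0$ be an integer and put $d=2^n$. Let $\boldsymbol{b}_1,\boldsymbol{b}_2,\boldsymbol{c}_1,\boldsymbol{c}_2,\boldsymbol{x}_1,\boldsymbol{x}_2\in\mathbb{R}^d$ and define $\boldsymbol{b}=(\boldsymbol{b}_1;\boldsymbol{b}_2)$, $\boldsymbol{c}=(\boldsymbol{c}_1;\boldsymbol{c}_2)$, $\boldsymbol{x}=(\boldsymbol{x}_1;\boldsymbol{x}_2)$ in $\mathbb{R}^{2d}$. Then the inequality $\boldsymbol{b}\le A_{n+1}\boldsymbol{x}\le\boldsymbol{c}$ is equivalent to the simultaneous inequalities $$\begin{cases}\rho_n(\boldsymbol{b})\le A_n\boldsymbol{x}_1\le\rho_n(\boldsymbol{c}),\\ \phi_n(A_n\boldsymbol{x}_1,\boldsymbol{b},\boldsymbol{c})\le A_n\boldsymbol{x}_2\le\psi_n(A_n\boldsymbol{x}_1,\boldsymbol{b},\boldsymbol{c}).\end{cases}$$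
   Context: For vectors $\boldsymbol{u},\boldsymbol{v}$ of the same dimension, $\boldsymbol{u}\le\boldsymbol{v}$ means componentwise inequality, and $\max(\boldsymbol{u},\boldsymbol{v})$, $\min(\boldsymbol{u},\boldsymbol{v})$ are taken componentwise. $(\boldsymbol{x}_1;\boldsymbol{x}_2)$ denotes vertical concatenation of column vectors. Define integers $\sigma(n,k)$, $n\ge 0$, $1\le k\le 2^n$, recursively by $\sigma(0,1)=1$ and, with $d=2^n$, $\sigma(n+1,k)=\sigma(n,k)$ if $1\le k\le d$, $\sigma(n+1,k)=2d+1-\sigma(n,k-d)$ if $d+1\le k\le 2d$. Define $\xi_{n,k}=2\cos\left(\frac{\pi(2\sigma(n,k)-1)}{2\cdot 2^n}\right)$ for $1\le k\le 2^n$. Let $D_n=\operatorname{diag}(\xi_{n+1,1},\dots,\xi_{n+1,2^n})\in\mathbb{R}^{2^n\times 2^n}$. Define matrices $A_n\in\mathbb{R}^{2^n\times 2^n}$ recursively by $A_0=1$ and $$A_{n+1}=\begin{pmatrix}A_n & D_nA_n\\ A_n & -D_nA_n\end{pmatrix}.$$ For $\boldsymbol{a}_1\in\mathbb{R}^{d}$ and $\boldsymbol{b}=(\boldsymbol{b}_1;\boldsymbol{b}_2),\ \boldsymbol{c}=(\boldsymbol{c}_1;\boldsymbol{c}_2)\in\mathbb{R}^{2d}$ with $\boldsymbol{b}_i,\boldsymbol{c}_i\in\mathbb{R}^d$, $d=2^n$, define $\rho_n(\boldsymbol{b})=(\boldsymbol{b}_1+\boldsymbol{b}_2)/2$, $\phi_n(\boldsymbol{a}_1,\boldsymbol{b},\boldsymbol{c})=D_n^{-1}\max(\boldsymbol{b}_1-\boldsymbol{a}_1,\,-\boldsymbol{c}_2+\boldsymbol{a}_1)$,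 $\psi_n(\boldsymbol{a}_1,\boldsymbol{b},\boldsymbol{c})=D_n^{-1}\min(\boldsymbol{c}_1-\boldsymbol{a}_1,\,-\boldsymbol{b}_2+\boldsymbol{a}_1)$, all in $\mathbb{R}^d$. *)

theory Defs
  imports Complex_Main "Jordan_Normal_Form.Gauss_Jordan_Elimination"
begin

(* The index k runs over 1 <= k <= 2^n. Only these values are used; the values of
   sigma and xi for other k have no meaning. *)
fun sigma :: "nat \<Rightarrow> nat \<Rightarrow> int" where
  "sigma 0 k = 1"
| "sigma (Suc n) k =
     (if k \<le> 2 ^ n then sigma n k else 2 * 2 ^ n + 1 - sigma n (k - 2 ^ n))"

definition xi :: "nat \<Rightarrow> nat \<Rightarrow> real" where
  "xi n k = 2 * cos (pi * (2 * real_of_int (sigma n k) - 1) / (2 * 2 ^ n))"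

(* Matrix and vector entries are indexed from 0, hence the shift k = i + 1. *)
definition D :: "nat \<Rightarrow> real mat" where
  "D n = mat_diag (2 ^ n) (\<lambda>i. xi (n + 1) (i + 1))"

(* The matrix D n is invertible: 1 <= sigma (n+1) k <= 2^n for 1 <= k <= 2^n, so its
   diagonal entries are 2 * cos t with 0 < t < pi/2. Hence mat_inverse (D n) is not None. *)
definition D_inv :: "nat \<Rightarrow> real mat" where
  "D_inv n = the (mat_inverse (D n))"

fun A :: "nat \<Rightarrow> real mat" where
  "A 0 = 1\<^sub>m 1"
| "A (Suc n) = four_block_mat (A n) (D n * A n) (A n) (- (D n * A n))"

(* The order on vec is componentwise, but vec has no lattice operations, and the generic
   max and min would compare whole vectors. *)
definition max_vec :: "real vec \<Rightarrow> real vec \<Rightarrow> real vec" where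
  "max_vec u v = vec (dim_vec u) (\<lambda>i. max (u $ i) (v $ i))"

definition min_vec :: "real vec \<Rightarrow> real vec \<Rightarrow> real vec" where
  "min_vec u v = vec (dim_vec u) (\<lambda>i. min (u $ i) (v $ i))"

(* The arguments b and c are vectors of dimension 2 * 2^n; vec_first and vec_last
   extract their two halves. *)
definition rho :: "nat \<Rightarrow> real vec \<Rightarrow> real vec" where
  "rho n b = (1 / 2) \<cdot>\<^sub>v (vec_first b (2 ^ n) + vec_last b (2 ^ n))"

definition phi :: "nat \<Rightarrow> real vec \<Rightarrow> real vec \<Rightarrow> real vec \<Rightarrow> real vec" where
  "phi n a1 b c =
     D_inv n *\<^sub>v max_vec (vec_first b (2 ^ n) - a1) (- vec_last c (2 ^ n) + a1)"

definition psi :: "nat \<Rightarrow> real vec \<Rightarrow> real vec \<Rightarrow> real vec \<Rightarrow> real vec" where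
  "psi n a1 b c =
     D_inv n *\<^sub>v min_vec (vec_first c (2 ^ n) - a1) (- vec_last b (2 ^ n) + a1)"

end

theory Submission
  imports Defs
begin

text \<open>
  Put \<^term>\<open>p = A n *\<^sub>v x1\<close>, \<^term>\<open>q = A n *\<^sub>v x2\<close> and \<^term>\<open>t = D n *\<^sub>v q\<close>. The block form of
  \<^term>\<open>A (Suc n)\<close> splits the constraint into \<open>b1 \<le> p + t \<le> c1\<close> and \<open>b2 \<le> p - t \<le> c2\<close>. Solving all
  four inequalities for \<open>t\<close> gives \<open>max (b1 - p) (p - c2) \<le> t \<le> min (c1 - p) (p - b2)\<close> in each
  coordinate (\<open>halves_between_iff\<close>). The bounds on \<open>p\<close> that come from \<^const>\<open>rho\<close> are the averages of
  the two constraints, in which \<open>t\<close> cancels: \<open>b1 - p \<le> t \<le> p - b2\<close> forces \<open>(b1 + b2) / 2 \<le> p\<close>,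
  and \<open>p - c2 \<le> t \<le> c1 - p\<close> forces \<open>p \<le> (c1 + c2) / 2\<close>.

  It remains to pass from \<open>t\<close> to \<open>q\<close>. This preserves the inequalities because the diagonal entries
  of \<^term>\<open>D n\<close> are positive (\<open>xi_Suc_pos\<close>): for \<open>k \<le> 2 ^ n\<close> the recursion of \<^const>\<open>sigma\<close>
  gives \<^prop>\<open>sigma (Suc n) k = sigma n k\<close>, which is at most \<^term>\<open>2 ^ n\<close> and not just at most
  \<^term>\<open>2 ^ Suc n\<close>, so the angle in \<^const>\<open>xi\<close> lies strictly below \<^term>\<open>pi / 2\<close>.
\<close>

text \<open>
  The second half of row \<open>n + 1\<close> is row \<open>n\<close> reflected by \<open>s \<mapsto> 2 * 2 ^ n + 1 - s\<close>, which maps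
  \<open>{1..2 ^ n}\<close> onto \<open>{2 ^ n + 1..2 * 2 ^ n}\<close>. The case \<open>k = 0\<close> lies outside the meaningful range
  but satisfies the same bounds.
\<close>

lemma sigma_bounds: "k \<le> 2 ^ n \<Longrightarrow> 1 \<le> sigma n k \<and> sigma n k \<le> 2 ^ n"
proof (induction n arbitrary: k)
  case 0
  then show ?case by simp
next
  case (Suc n)
  show ?case
  proof (cases "k \<le> 2 ^ n")
    case True
    have "(2::int) ^ n \<le> 2 ^ Suc n" by simp
    with True Suc.IH[OF True] show ?thesis by (auto intro: order_trans)
  next
    case False
    with Suc.prems have "k - 2 ^ n \<le> 2 ^ n" by simp
    from Suc.IH[OF this] False show ?thesis by simp
  qed
qed

text \<open>
  The range of \<open>k\<close> is half of the one on which row \<open>Suc n\<close> lives: there \<^const>\<open>sigma\<close> is still that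
  of row \<open>n\<close>, while the denominator of the angle has doubled, which keeps the angle below
  \<^term>\<open>pi / 2\<close>.
\<close>

lemma xi_Suc_pos:
  assumes "k \<le> 2 ^ n"
  shows "xi (Suc n) k > 0"
proof -
  define s where "s = real_of_int (sigma n k)"
  from sigma_bounds[OF assms] have "real_of_int 1 \<le> s" "s \<le> real_of_int (2 ^ n)"
    unfolding s_def by linarith+
  then have s: "1 \<le> s" "s \<le> 2 ^ n" by simp_all
  let ?\<theta> = "pi * (2 * s - 1) / (2 * 2 ^ Suc n)"
  have "0 < ?\<theta>" using s by simp
  moreover have "?\<theta> < pi / 2"
  proof -
    have "(2 * s - 1) / (2 * 2 ^ Suc n) < 1 / 2" using s by (simp add: field_simps)
    from mult_strict_left_mono[OF this pi_gt_zero] show ?thesis by simp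
  qed
  ultimately have "cos ?\<theta> > 0" by (intro cos_gt_zero)
  with assms show ?thesis by (simp add: xi_def s_def)
qed

text \<open>
  \<^const>\<open>mat_inverse\<close> is computed by Gauss--Jordan elimination; rather than following the algorithm,
  one can use that it succeeds on every unit of the matrix ring and that two-sided inverses are
  unique.
\<close>

lemma mat_inverse_mat_diag:
  fixes f :: "nat \<Rightarrow> 'a :: field"
  assumes "\<And>i. i < m \<Longrightarrow> f i \<noteq> 0"
  shows "mat_inverse (mat_diag m f) = Some (mat_diag m (\<lambda>i. 1 / f i))"
proof -
  let ?D = "mat_diag m f" and ?E = "mat_diag m (\<lambda>i. 1 / f i)"
  have D: "?D \<in> carrier_mat m m" and E: "?E \<in> carrier_mat m m" by simp_all
  have DE: "?D * ?E = 1\<^sub>m m" and ED: "?E * ?D = 1\<^sub>m m"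
    unfolding mat_diag_diag using assms by (auto intro!: eq_matI simp: mat_diag_def)
  have "?D \<in> Units (ring_mat TYPE('a) m ())"
    unfolding Units_def using D E DE ED by (auto simp: ring_mat_simps simp del: mat_diag_diag)
  with mat_inverse(1)[OF D, where b = "()"] obtain B where B: "mat_inverse ?D = Some B"
    by (cases "mat_inverse ?D") auto
  with mat_inverse(2)[OF D] have BD: "B * ?D = 1\<^sub>m m" and carr: "B \<in> carrier_mat m m" by auto
  have "B = B * (?D * ?E)" using DE carr by simp
  also have "\<dots> = ?E" by (simp only: assoc_mult_mat[OF carr D E, symmetric] BD left_mult_one_mat[OF E])
  finally show ?thesis using B by simp
qed

lemma mat_diag_mult_vec_index:
  assumes "v \<in> carrier_vec m" "i < m"
  shows "(mat_diag m f *\<^sub>v v) $ i = (f i :: 'a :: semiring_0) * v $ i"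
proof -
  have "(mat_diag m f *\<^sub>v v) $ i = (\<Sum>j = 0..<m. (if i = j then f j else 0) * v $ j)"
    using assms by (simp add: scalar_prod_def mat_diag_def)
  also have "\<dots> = (\<Sum>j = 0..<m. (if i = j then f j * v $ j else 0))"
    by (intro sum.cong) auto
  also have "\<dots> = f i * v $ i" using assms by simp
  finally show ?thesis .
qed

lemma D_inv_eq_mat_diag: "D_inv n = mat_diag (2 ^ n) (\<lambda>i. 1 / xi (Suc n) (Suc i))"
proof -
  have "xi (Suc n) (Suc j) \<noteq> 0" if "j < 2 ^ n" for j
    using xi_Suc_pos[of "Suc j" n] that by simp
  then show ?thesis by (simp add: D_inv_def D_def mat_inverse_mat_diag)
qed

lemma D_inv_mult_vec_index:
  assumes "v \<in> carrier_vec (2 ^ n)" "i < 2 ^ n"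
  shows "(D_inv n *\<^sub>v v) $ i = v $ i / xi (Suc n) (Suc i)"
  using assms by (simp add: D_inv_eq_mat_diag mat_diag_mult_vec_index)

lemma D_carrier [simp]: "D n \<in> carrier_mat (2 ^ n) (2 ^ n)"
  by (simp add: D_def)

lemma D_inv_dim_row [simp]: "dim_row (D_inv n) = 2 ^ n"
  by (simp add: D_inv_eq_mat_diag mat_diag_def)

lemma A_carrier [simp]: "A n \<in> carrier_mat (2 ^ n) (2 ^ n)"
proof (induction n)
  case (Suc n)
  then have "A (Suc n) \<in> carrier_mat (2 ^ n + 2 ^ n) (2 ^ n + 2 ^ n)"
    unfolding A.simps using mult_carrier_mat[OF D_carrier Suc] by (intro four_block_carrier_mat) auto
  then show ?case by (simp add: mult_2)
qed simp

lemma A_Suc_mult_append_vec: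
  assumes "u \<in> carrier_vec (2 ^ n)" "v \<in> carrier_vec (2 ^ n)"
  shows "A (Suc n) *\<^sub>v (u @\<^sub>v v) =
    (A n *\<^sub>v u + D n *\<^sub>v (A n *\<^sub>v v)) @\<^sub>v (A n *\<^sub>v u - D n *\<^sub>v (A n *\<^sub>v v))"
proof -
  have DA: "D n * A n \<in> carrier_mat (2 ^ n) (2 ^ n)" by (rule mult_carrier_mat[OF D_carrier A_carrier])
  have "A (Suc n) *\<^sub>v (u @\<^sub>v v) =
    (A n *\<^sub>v u + (D n * A n) *\<^sub>v v) @\<^sub>v (A n *\<^sub>v u + (- (D n * A n)) *\<^sub>v v)"
    unfolding A.simps using DA assms by (intro four_block_mat_mult_vec) auto
  also have "(- (D n * A n)) *\<^sub>v v = - ((D n * A n) *\<^sub>v v)"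
    using DA assms by (intro uminus_mult_mat_vec) auto
  also have "(D n * A n) *\<^sub>v v = D n *\<^sub>v (A n *\<^sub>v v)"
    using assms by (intro assoc_mult_mat_vec[of _ "2^n" "2^n"]) auto
  also have "A n *\<^sub>v u + - (D n *\<^sub>v (A n *\<^sub>v v)) = A n *\<^sub>v u - D n *\<^sub>v (A n *\<^sub>v v)"
    by (intro eq_vecI) auto
  finally show ?thesis .
qed

text \<open>
  One coordinate of the theorem, with \<open>\<delta>\<close> the diagonal entry of \<^const>\<open>D\<close>. Multiplying by
  \<open>\<delta> > 0\<close> turns the bounds on \<open>q\<close> into the four inequalities on the left; the sums of those with
  \<open>b1\<close>, \<open>b2\<close> and of those with \<open>c1\<close>, \<open>c2\<close> are free of \<open>q\<close> and bound \<open>p\<close>.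
\<close>

lemma halves_between_iff:
  fixes p q \<delta> b1 b2 c1 c2 :: real
  assumes "\<delta> > 0"
  shows "(b1 \<le> p + \<delta> * q \<and> b2 \<le> p - \<delta> * q) \<and> (p + \<delta> * q \<le> c1 \<and> p - \<delta> * q \<le> c2) \<longleftrightarrow>
    ((b1 + b2) / 2 \<le> p \<and> p \<le> (c1 + c2) / 2) \<and>
    (max (b1 - p) (p - c2) / \<delta> \<le> q \<and> q \<le> min (c1 - p) (p - b2) / \<delta>)"
proof -
  have "max (b1 - p) (p - c2) / \<delta> \<le> q \<longleftrightarrow> b1 - p \<le> \<delta> * q \<and> p - c2 \<le> \<delta> * q"
    using assms by (simp add: pos_divide_le_eq mult.commute)
  moreover have "q \<le> min (c1 - p) (p - b2) / \<delta> \<longleftrightarrow> \<delta> * q \<le> c1 - p \<and> \<delta> * q \<le> p - b2"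
    using assms by (simp add: pos_le_divide_eq mult.commute)
  ultimately show ?thesis by auto
qed

lemma vec_le_iff_index:
  assumes "u \<in> carrier_vec m" "v \<in> carrier_vec m"
  shows "u \<le> v \<longleftrightarrow> (\<forall>i < m. u $ i \<le> v $ i)"
  using assms by (auto simp: less_eq_vec_def)

theorem lemma3p3:
  fixes n d :: nat and b1 b2 c1 c2 x1 x2 b c x :: "real vec"
  assumes "d = 2 ^ n"
    and "b1 \<in> carrier_vec d" "b2 \<in> carrier_vec d"
    and "c1 \<in> carrier_vec d" "c2 \<in> carrier_vec d"
    and "x1 \<in> carrier_vec d" "x2 \<in> carrier_vec d"
    and "b = b1 @\<^sub>v b2" and "c = c1 @\<^sub>v c2" and "x = x1 @\<^sub>v x2"
  shows "b \<le> A (n + 1) *\<^sub>v x \<and> A (n + 1) *\<^sub>v x \<le> c \<longleftrightarrow>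
    (rho n b \<le> A n *\<^sub>v x1 \<and> A n *\<^sub>v x1 \<le> rho n c) \<and>
    (phi n (A n *\<^sub>v x1) b c \<le> A n *\<^sub>v x2 \<and> A n *\<^sub>v x2 \<le> psi n (A n *\<^sub>v x1) b c)"
proof -
  define p q where "p = A n *\<^sub>v x1" and "q = A n *\<^sub>v x2"
  define \<delta> where "\<delta> = (\<lambda>i. xi (Suc n) (Suc i))"
  have carr: "b1 \<in> carrier_vec (2 ^ n)" "b2 \<in> carrier_vec (2 ^ n)"
    "c1 \<in> carrier_vec (2 ^ n)" "c2 \<in> carrier_vec (2 ^ n)"
    "x1 \<in> carrier_vec (2 ^ n)" "x2 \<in> carrier_vec (2 ^ n)"
    using assms by simp_all
  have pq: "p \<in> carrier_vec (2 ^ n)" "q \<in> carrier_vec (2 ^ n)"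
    unfolding p_def q_def using carr mult_mat_vec_carrier[OF A_carrier] by blast+
  have halves: "vec_first b (2 ^ n) = b1" "vec_last b (2 ^ n) = b2"
    "vec_first c (2 ^ n) = c1" "vec_last c (2 ^ n) = c2"
    using assms(8,9) carr by (auto simp: vec_first_def vec_last_def intro!: eq_vecI)
  have Dq: "D n *\<^sub>v q \<in> carrier_vec (2 ^ n)"
    using pq mult_mat_vec_carrier[OF D_carrier] by blast
  have Dq_index: "(D n *\<^sub>v q) $ i = \<delta> i * q $ i" if "i < 2 ^ n" for i
    using that pq by (simp add: D_def \<delta>_def mat_diag_mult_vec_index)
  have phi_index: "phi n p b c $ i = max (b1 $ i - p $ i) (p $ i - c2 $ i) / \<delta> i"
    if "i < 2 ^ n" for i
    unfolding phi_def halves using that carr pq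
    by (subst D_inv_mult_vec_index) (auto simp: max_vec_def \<delta>_def)
  have psi_index: "psi n p b c $ i = min (c1 $ i - p $ i) (p $ i - b2 $ i) / \<delta> i"
    if "i < 2 ^ n" for i
    unfolding psi_def halves using that carr pq
    by (subst D_inv_mult_vec_index) (auto simp: min_vec_def \<delta>_def)
  have carr': "phi n p b c \<in> carrier_vec (2 ^ n)" "psi n p b c \<in> carrier_vec (2 ^ n)"
    "rho n b \<in> carrier_vec (2 ^ n)" "rho n c \<in> carrier_vec (2 ^ n)"
    unfolding phi_def psi_def rho_def by (auto intro: carrier_vecI)
  have rho_index: "rho n b $ i = (b1 $ i + b2 $ i) / 2" "rho n c $ i = (c1 $ i + c2 $ i) / 2"
    if "i < 2 ^ n" for i
    unfolding rho_def halves using that carr by simp_all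
  have "A (n + 1) *\<^sub>v x = (p + D n *\<^sub>v q) @\<^sub>v (p - D n *\<^sub>v q)"
    using A_Suc_mult_append_vec carr assms(10) by (simp add: p_def q_def del: A.simps)
  then have "b \<le> A (n + 1) *\<^sub>v x \<and> A (n + 1) *\<^sub>v x \<le> c \<longleftrightarrow>
    (b1 \<le> p + D n *\<^sub>v q \<and> b2 \<le> p - D n *\<^sub>v q) \<and> (p + D n *\<^sub>v q \<le> c1 \<and> p - D n *\<^sub>v q \<le> c2)"
    using assms(8,9) carr pq Dq by (simp add: append_vec_le[of _ "2 ^ n"])
  also have "\<dots> \<longleftrightarrow> (\<forall>i < 2 ^ n.
      (b1 $ i \<le> p $ i + \<delta> i * q $ i \<and> b2 $ i \<le> p $ i - \<delta> i * q $ i) \<and>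
      (p $ i + \<delta> i * q $ i \<le> c1 $ i \<and> p $ i - \<delta> i * q $ i \<le> c2 $ i))"
  proof -
    have "(p + D n *\<^sub>v q) $ i = p $ i + \<delta> i * q $ i" "(p - D n *\<^sub>v q) $ i = p $ i - \<delta> i * q $ i"
      if "i < 2 ^ n" for i
      using that pq carrier_matD(1)[OF D_carrier, of n] by (auto simp: Dq_index[symmetric])
    moreover have "p + D n *\<^sub>v q \<in> carrier_vec (2 ^ n)" "p - D n *\<^sub>v q \<in> carrier_vec (2 ^ n)"
      using pq Dq by auto
    ultimately show ?thesis
      using carr by (simp add: vec_le_iff_index[of _ "2 ^ n"] imp_conjR all_conj_distrib)
  qed
  also have "\<dots> \<longleftrightarrow> (\<forall>i < 2 ^ n.
      ((b1 $ i + b2 $ i) / 2 \<le> p $ i \<and> p $ i \<le> (c1 $ i + c2 $ i) / 2) \<and>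
      (max (b1 $ i - p $ i) (p $ i - c2 $ i) / \<delta> i \<le> q $ i \<and>
       q $ i \<le> min (c1 $ i - p $ i) (p $ i - b2 $ i) / \<delta> i))"
    by (intro all_cong halves_between_iff) (simp add: \<delta>_def xi_Suc_pos)
  also have "\<dots> \<longleftrightarrow> (rho n b \<le> p \<and> p \<le> rho n c) \<and> (phi n p b c \<le> q \<and> q \<le> psi n p b c)"
    using pq carr' by (simp add: vec_le_iff_index[of _ "2 ^ n"] rho_index phi_index psi_index
      imp_conjR all_conj_distrib)
  finally show ?thesis unfolding p_def q_def .
qed

end
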